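(* For a permutation $\rho$ of $\{1,2,3\}$, let $a_{n,k}^{\mathrm{pk}}(\rho)$ denote the number of permutations of $\{1,\dots,n\}$ that avoid $\rho$ and have exactly $k$ peaks. Then for all $n$ and $k$, $$a_{n,k}^{\mathrm{pk}}(312)=a_{n,k}^{\mathrm{pk}}(321).$$
   Context: Here $n,k$ are nonnegative integers. $\mathcal{S}_n$ is the set of permutations $\pi=\pi_1\cdots\pi_n$ of $\{1,\dots,n\}$. For $\rho\in\mathcal{S}_m$, $\pi\in\mathcal{S}_n$ contains $\rho$ if there are indices $1\le i_1<\cdots<i_m\le n$ such that $\pi_{i_a}<\pi_{i_b}$ if and only if $\rho_a<\rho_b$; otherwise $\pi$ avoids $\rho$. The number of peaks is $\mathrm{pk}(\pi)=|\{i : \pi_i<\pi_{i+1}\text{ and }\pi_{i+1}>\pi_{i+2}\}|$, where $1\le i\le n-2$. *)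

theory Defs
  imports "HOL-Combinatorics.Multiset_Permutations"
begin

(* A permutation of {1..n} is the word of its values (one-line notation), i.e. an element
   of permutations_of_set {1..n}.  List positions are counted from 0, values from 1. *)

definition contains_pattern :: "nat list \<Rightarrow> nat list \<Rightarrow> bool" where
  "contains_pattern \<pi> \<rho> \<longleftrightarrow>
     (\<exists>f :: nat \<Rightarrow> nat.
        strict_mono_on {..<length \<rho>} f \<and>
        (\<forall>a<length \<rho>. f a < length \<pi>) \<and>
        (\<forall>a<length \<rho>. \<forall>b<length \<rho>. \<pi> ! f a < \<pi> ! f b \<longleftrightarrow> \<rho> ! a < \<rho> ! b))"

definition avoids_pattern :: "nat list \<Rightarrow> nat list \<Rightarrow> bool" where
  "avoids_pattern \<pi> \<rho> \<longleftrightarrow> \<not> contains_pattern \<pi> \<rho>"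

definition pk :: "nat list \<Rightarrow> nat" where
  "pk \<pi> = card {i. i + 2 < length \<pi> \<and> \<pi> ! i < \<pi> ! (i + 1) \<and> \<pi> ! (i + 1) > \<pi> ! (i + 2)}"

definition a_pk :: "nat \<Rightarrow> nat \<Rightarrow> nat list \<Rightarrow> nat" where
  "a_pk n k \<rho> = card {\<pi> \<in> permutations_of_set {1..n}. avoids_pattern \<pi> \<rho> \<and> pk \<pi> = k}"

end

theory Submission
  imports Defs
begin

text \<open>
  Both classes are compared through the sequence of prefix maxima. An entry lying below the current
  prefix maximum is dominated, and 312 or 321 occurs exactly when two dominated entries under a
  common earlier entry ascend or descend. Swapping two such entries keeps the prefix maxima,
  so an extremal permutation with given prefix maxima avoids the pattern; and two avoiders with the
  same prefix maxima agree, because at their first difference one of them has an occurrence.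
  In an avoider every peak top is a prefix maximum, so the prefix maxima determine the number of peaks.
\<close>

section \<open>Prefix maxima and their invariance under swapping dominated entries\<close>

definition prefix_maxima :: "nat list \<Rightarrow> nat list" where
  "prefix_maxima xs = map (\<lambda>i. Max ((!) xs ` {..i})) [0..<length xs]"

text \<open>The injective weight \<open>w\<close> treats both patterns at once: \<open>w = int\<close> gives 321,
  and \<open>w = (\<lambda>x. - int x)\<close> gives 312.\<close>

definition dominated_inversion :: "(nat \<Rightarrow> int) \<Rightarrow> nat list \<Rightarrow> bool" where
  "dominated_inversion w xs \<longleftrightarrow>
     (\<exists>i j k. i < j \<and> j < k \<and> k < length xs \<and> xs ! j < xs ! i \<and> xs ! k < xs ! i \<and>
        w (xs ! k) < w (xs ! j))"

lemma dominated_inversionI: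
  assumes "i < j" "j < k" "k < length xs" "xs ! j < xs ! i" "xs ! k < xs ! i"
    "w (xs ! k) < w (xs ! j)"
  shows "dominated_inversion w xs"
  using assms unfolding dominated_inversion_def by blast

lemma length_prefix_maxima [simp]: "length (prefix_maxima xs) = length xs"
  by (simp add: prefix_maxima_def)

lemma prefix_maxima_nth:
  "i < length xs \<Longrightarrow> prefix_maxima xs ! i = Max ((!) xs ` {..i})"
  by (simp add: prefix_maxima_def)

lemma prefix_maxima_Suc:
  assumes "Suc i < length xs"
  shows "prefix_maxima xs ! Suc i = max (prefix_maxima xs ! i) (xs ! Suc i)"
  using assms by (simp add: prefix_maxima_nth atMost_Suc max.commute)

lemma nth_le_prefix_maxima:
  assumes "j \<le> i" "i < length xs"
  shows "xs ! j \<le> prefix_maxima xs ! i"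
  using assms by (simp add: prefix_maxima_nth)

lemma prefix_maxima_attained:
  assumes "i < length xs"
  obtains j where "j \<le> i" "prefix_maxima xs ! i = xs ! j"
proof -
  have "Max ((!) xs ` {..i}) \<in> (!) xs ` {..i}" by (intro Max_in) auto
  then obtain j where "j \<le> i" "Max ((!) xs ` {..i}) = xs ! j" by blast
  then show thesis using that assms by (simp add: prefix_maxima_nth)
qed

lemma prefix_maxima_eqI:
  assumes "length xs = length ys"
    and "\<And>i. i < length xs \<Longrightarrow> \<exists>j\<le>i. xs ! i \<le> ys ! j"
    and "\<And>i. i < length xs \<Longrightarrow> \<exists>j\<le>i. ys ! i \<le> xs ! j"
  shows "prefix_maxima xs = prefix_maxima ys"
proof (rule nth_equalityI)
  have le: "prefix_maxima us ! i \<le> prefix_maxima vs ! i"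
    if "i < length us" "length us = length vs"
      and dom: "\<And>i. i < length us \<Longrightarrow> \<exists>j\<le>i. us ! i \<le> vs ! j" for us vs :: "nat list" and i
  proof -
    obtain j where j: "j \<le> i" "prefix_maxima us ! i = us ! j"
      using prefix_maxima_attained[OF \<open>i < length us\<close>] .
    then obtain l where "l \<le> j" "us ! j \<le> vs ! l" using dom[of j] \<open>i < length us\<close> by auto
    then show ?thesis using j nth_le_prefix_maxima[of l i vs] that by auto
  qed
  fix i assume "i < length (prefix_maxima xs)"
  then have "i < length xs" "i < length ys" using assms(1) by simp_all
  then show "prefix_maxima xs ! i = prefix_maxima ys ! i"
    using le[OF _ assms(1,2)] le[OF _ assms(1)[symmetric]] assms(1,3) by (metis antisym)
qed (use assms in simp)

text \<open>Both swapped entries stay behind the larger entry \<open>xs ! i\<close>, so they never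
  contribute to a prefix maximum. Position \<open>i\<close> serves as the witness at
  \<open>j\<close> and \<open>k\<close>; any other position is its own witness.\<close>

lemma prefix_maxima_swap_dominated:
  assumes "i < j" "j < k" "k < length xs" "xs ! j < xs ! i" "xs ! k < xs ! i"
  shows "prefix_maxima (xs[j := xs ! k, k := xs ! j]) = prefix_maxima xs"
proof (rule prefix_maxima_eqI)
  let ?ys = "xs[j := xs ! k, k := xs ! j]"
  fix l assume l: "l < length ?ys"
  have i: "?ys ! i = xs ! i" using assms by simp
  show "\<exists>m\<le>l. ?ys ! l \<le> xs ! m"
  proof (cases "l = j \<or> l = k")
    case True
    then have "?ys ! l \<le> xs ! i" "i \<le> l" using assms by (auto simp: nth_list_update)
    then show ?thesis by blast
  qed auto
  show "\<exists>m\<le>l. xs ! l \<le> ?ys ! m"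
  proof (cases "l = j \<or> l = k")
    case True
    then have "xs ! l \<le> ?ys ! i" "i \<le> l" using assms i by auto
    then show ?thesis by blast
  next
    case False
    then have "xs ! l \<le> ?ys ! l" by simp
    then show ?thesis by blast
  qed
qed simp

section \<open>Existence: maximising a potential over words with given prefix maxima\<close>

text \<open>The swap moves the larger weight to the later position. Only the terms at
  \<open>j\<close> and \<open>k\<close> change, and their total change factors into two positive
  differences.\<close>

lemma sum_index_weight_swap_less:
  fixes w :: "nat \<Rightarrow> int"
  assumes "j < k" "k < length xs" "w (xs ! k) < w (xs ! j)"
  defines "ys \<equiv> xs[j := xs ! k, k := xs ! j]"
  shows "(\<Sum>i<length xs. int i * w (xs ! i)) < (\<Sum>i<length xs. int i * w (ys ! i))"
proof -
  have "(\<Sum>i<length xs. int i * w (ys ! i)) - (\<Sum>i<length xs. int i * w (xs ! i)) =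
        (\<Sum>i<length xs. int i * w (ys ! i) - int i * w (xs ! i))"
    by (simp add: sum_subtractf)
  also have "\<dots> = (\<Sum>i\<in>{j, k}. int i * w (ys ! i) - int i * w (xs ! i))"
    using assms(1,2) by (intro sum.mono_neutral_right) (auto simp: ys_def)
  also have "\<dots> = (int k - int j) * (w (xs ! j) - w (xs ! k))"
    using assms(1,2) by (simp add: ys_def algebra_simps)
  also have "\<dots> > 0" using assms(1,3) by simp
  finally show ?thesis by simp
qed

text \<open>Among the finitely many permutations with the same prefix maxima, take one maximising
  the index-weighted sum: swapping the last two entries of a dominated inversion would stay in this
  set and increase the sum.\<close>

lemma ex_no_dominated_inversion:
  assumes "finite A" "xs \<in> permutations_of_set A"
  obtains ys where "ys \<in> permutations_of_set A" "prefix_maxima ys = prefix_maxima xs"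
    "\<not> dominated_inversion w ys"
proof -
  define S where "S = {ys \<in> permutations_of_set A. prefix_maxima ys = prefix_maxima xs}"
  define \<phi> where "\<phi> ys = (\<Sum>i<length ys. int i * w (ys ! i))" for ys
  have "finite S" "xs \<in> S" using assms by (auto simp: S_def)
  then have "Max (\<phi> ` S) \<in> \<phi> ` S" by (intro Max_in) auto
  then obtain ys where ys: "ys \<in> S" and "\<phi> ys = Max (\<phi> ` S)" by auto
  then have max: "\<phi> zs \<le> \<phi> ys" if "zs \<in> S" for zs
    using that \<open>finite S\<close> by simp
  have "\<not> dominated_inversion w ys"
  proof
    assume "dominated_inversion w ys"
    then obtain i j k where ijk: "i < j" "j < k" "k < length ys" "ys ! j < ys ! i"
      "ys ! k < ys ! i" "w (ys ! k) < w (ys ! j)"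
      unfolding dominated_inversion_def by blast
    let ?zs = "ys[j := ys ! k, k := ys ! j]"
    have "?zs \<in> S"
      using ys ijk prefix_maxima_swap_dominated[OF ijk(1-5)]
      by (simp add: S_def permutations_of_set_def)
    moreover have "\<phi> ys < \<phi> ?zs"
      using sum_index_weight_swap_less[OF ijk(2,3,6)] by (simp add: \<phi>_def)
    ultimately show False using max by fastforce
  qed
  then show thesis using that[of ys] ys by (simp add: S_def)
qed

section \<open>Uniqueness: comparing two words at their first difference\<close>

text \<open>The value \<open>ys ! i\<close> must occur in \<open>xs\<close> after position
  \<open>i\<close>, since the prefixes before \<open>i\<close> agree. Together with
  \<open>xs ! c\<close> and \<open>xs ! i\<close> it forms the inversion.\<close>

lemma dominated_inversionI_first_difference:
  assumes "distinct xs" "set xs = set ys"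
    and i: "i < length xs" "i < length ys"
    and prefix: "\<And>l. l < i \<Longrightarrow> xs ! l = ys ! l"
    and c: "c < i" "xs ! i < xs ! c" "ys ! i < xs ! c"
    and w: "w (ys ! i) < w (xs ! i)"
    and "distinct ys"
  shows "dominated_inversion w xs"
proof -
  have "ys ! i \<in> set xs" using assms by simp
  then obtain k where k: "k < length xs" "xs ! k = ys ! i" by (auto simp: in_set_conv_nth)
  \<comment> \<open>For \<open>k < i\<close> the value \<open>ys ! i\<close> would also stand at
    position \<open>k\<close> of \<open>ys\<close>.\<close>
  have "\<not> k < i" using prefix k i \<open>distinct ys\<close> by (metis less_irrefl nth_eq_iff_index_eq order.strict_trans)
  moreover have "k \<noteq> i" using w k by auto
  ultimately have "i < k" by simp
  then show ?thesis
    using dominated_inversionI[of c i k xs w] c k w by simp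
qed

lemma no_dominated_inversion_unique:
  assumes "inj w"
    and xs: "distinct xs" "\<not> dominated_inversion w xs"
    and ys: "distinct ys" "\<not> dominated_inversion w ys"
    and "set xs = set ys"
    and pm: "prefix_maxima xs = prefix_maxima ys"
  shows "xs = ys"
proof (rule ccontr)
  assume "xs \<noteq> ys"
  have len: "length xs = length ys" using pm length_prefix_maxima by metis
  define i where "i = (LEAST i. i < length xs \<and> xs ! i \<noteq> ys ! i)"
  have "\<exists>i. i < length xs \<and> xs ! i \<noteq> ys ! i" using len \<open>xs \<noteq> ys\<close> nth_equalityI by blast
  then have i: "i < length xs" "xs ! i \<noteq> ys ! i"
    unfolding i_def by (metis (mono_tags, lifting) LeastI_ex)+
  have prefix: "xs ! l = ys ! l" if "l < i" for l
    using not_less_Least[of l "\<lambda>i. i < length xs \<and> xs ! i \<noteq> ys ! i"] that i(1)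
    unfolding i_def by auto
  \<comment> \<open>The first entry is its own prefix maximum, so the words agree at position
    0.\<close>
  obtain i' where i': "i = Suc i'"
  proof (cases i)
    case 0
    then show ?thesis using i pm prefix_maxima_nth[of 0 xs] prefix_maxima_nth[of 0 ys] len by simp
  qed
  obtain c where c: "c \<le> i'" "prefix_maxima xs ! i' = xs ! c"
    using prefix_maxima_attained[of i' xs] i i' by auto
  \<comment> \<open>If either entry at \<open>i\<close> exceeded the previous maximum, equality of
    the new maxima would force both entries to be equal. Hence both are dominated by
    \<open>xs ! c\<close>.\<close>
  have "max (xs ! c) (xs ! i) = max (xs ! c) (ys ! i)"
    using prefix_maxima_Suc[of i' xs] prefix_maxima_Suc[of i' ys] i i' len pm c by simp
  moreover have "xs ! c \<noteq> xs ! i" "ys ! c \<noteq> ys ! i"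
    using xs ys i c i' len by (simp_all add: nth_eq_iff_index_eq)
  moreover have "xs ! c = ys ! c" using prefix c i' by simp
  ultimately have dom: "xs ! i < xs ! c" "ys ! i < xs ! c"
    using i(2) by (auto simp: max_def split: if_splits)
  have "w (xs ! i) \<noteq> w (ys ! i)" using i(2) \<open>inj w\<close> by (simp add: inj_eq)
  then consider "w (ys ! i) < w (xs ! i)" | "w (xs ! i) < w (ys ! i)" by linarith
  then show False
  proof cases
    case 1
    then show False
      using dominated_inversionI_first_difference[of xs ys i c w] assms dom c i' i len prefix by simp
  next
    case 2
    then show False
      using dominated_inversionI_first_difference[of ys xs i c w] assms dom c i' i len prefix
        \<open>xs ! c = ys ! c\<close> by simp
  qed
qed

text \<open>Injectivity is the uniqueness result, surjectivity the extremal one. The target does not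
  depend on \<open>w\<close>, which makes different weights comparable.\<close>

lemma bij_betw_prefix_maxima:
  assumes "inj w" "finite A"
  shows "bij_betw prefix_maxima {xs \<in> permutations_of_set A. \<not> dominated_inversion w xs}
           (prefix_maxima ` permutations_of_set A)"
proof (rule bij_betw_imageI)
  show "inj_on prefix_maxima {xs \<in> permutations_of_set A. \<not> dominated_inversion w xs}"
    using no_dominated_inversion_unique[OF \<open>inj w\<close>]
    by (auto intro!: inj_onI simp: permutations_of_set_def)
  show "prefix_maxima ` {xs \<in> permutations_of_set A. \<not> dominated_inversion w xs} =
          prefix_maxima ` permutations_of_set A"
  proof (intro equalityI subsetI)
    fix m assume "m \<in> prefix_maxima ` permutations_of_set A"
    then obtain xs where "xs \<in> permutations_of_set A" "m = prefix_maxima xs" by auto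
    then show "m \<in> prefix_maxima ` {xs \<in> permutations_of_set A. \<not> dominated_inversion w xs}"
      using ex_no_dominated_inversion[OF \<open>finite A\<close>, of xs w] by (metis (mono_tags, lifting) image_eqI mem_Collect_eq)
  qed auto
qed

section \<open>Reading peaks off the prefix maxima\<close>

text \<open>A peak whose top is a new maximum is a rise of \<open>m\<close> followed by a plateau. A
  dominated peak top would create a dominated inversion, for increasing and for decreasing weights
  alike.\<close>

lemma pk_eq_card_prefix_maxima:
  assumes "distinct xs" "\<not> dominated_inversion w xs"
    and w: "strict_mono w \<or> strict_antimono_on UNIV w"
  defines "m \<equiv> prefix_maxima xs"
  shows "pk xs = card {i. i + 2 < length m \<and> m ! i < m ! (i + 1) \<and> m ! (i + 2) = m ! (i + 1)}"
proof -
  have "xs ! i < xs ! (i + 1) \<and> xs ! (i + 1) > xs ! (i + 2) \<longleftrightarrow>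
        m ! i < m ! (i + 1) \<and> m ! (i + 2) = m ! (i + 1)" (is "?peak \<longleftrightarrow> ?plateau")
    if i: "i + 2 < length xs" for i
  proof
    have Suc: "m ! (i + 1) = max (m ! i) (xs ! (i + 1))" "m ! (i + 2) = max (m ! (i + 1)) (xs ! (i + 2))"
      using i prefix_maxima_Suc[of i xs] prefix_maxima_Suc[of "i + 1" xs] by (auto simp: m_def)
    have le: "xs ! i \<le> m ! i" using nth_le_prefix_maxima[of i i xs] i by (simp add: m_def)
    obtain c where c: "c \<le> i" "m ! i = xs ! c"
      using prefix_maxima_attained[of i xs] i by (auto simp: m_def)
    show ?plateau if peak: ?peak
    proof -
      have "m ! i < xs ! (i + 1)"
      proof (rule ccontr)
        assume "\<not> m ! i < xs ! (i + 1)"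
        moreover have "xs ! c \<noteq> xs ! (i + 1)"
          using c i \<open>distinct xs\<close> by (simp add: nth_eq_iff_index_eq)
        ultimately have gt: "xs ! (i + 1) < xs ! c" using c by simp
        \<comment> \<open>The dominating entry has to precede the whole peak, because the inversion
          found below may start at \<open>i\<close>.\<close>
        then have "c \<noteq> i" using peak by auto
        then have "c < i" using c by simp
        \<comment> \<open>An increasing weight turns the descent after the peak top into the
          inversion, a decreasing one the ascent before it.\<close>
        show False
        proof (cases "strict_mono w")
          case True
          then have "w (xs ! (i + 2)) < w (xs ! (i + 1))" using peak by (simp add: strict_mono_less)
          then show False
            using assms(2) gt peak i \<open>c < i\<close>
              dominated_inversionI[of c "i + 1" "i + 2" xs w] by simp
        next
          case False
          then have "w (xs ! (i + 1)) < w (xs ! i)"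
            using peak w by (auto simp: monotone_on_def)
          moreover have "i + 1 < length xs" using i by simp
          ultimately show False
            using assms(2) gt peak \<open>c < i\<close>
              dominated_inversionI[of c i "i + 1" xs w] by simp
        qed
      qed
      then show ?thesis using Suc peak by simp
    qed
    show ?peak if plateau: ?plateau
    proof -
      \<comment> \<open>The rise of \<open>m\<close> makes \<open>xs ! (i + 1)\<close> the new
        maximum; the plateau bounds the next entry by it, and distinctness makes the descent
        strict.\<close>
      have "xs ! (i + 1) \<noteq> xs ! (i + 2)" using i \<open>distinct xs\<close> by (simp add: nth_eq_iff_index_eq)
      then show ?thesis using plateau Suc le by (auto simp: max_def split: if_splits)
    qed
  qed
  then show ?thesis unfolding pk_def by (intro arg_cong[of _ _ card]) (auto simp: m_def)
qed

section \<open>Patterns of length three as dominated inversions\<close>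

lemma contains_pattern_length3:
  "contains_pattern xs [p, q, r] \<longleftrightarrow>
     (\<exists>i j k. i < j \<and> j < k \<and> k < length xs \<and>
        (\<forall>a<3. \<forall>b<3. xs ! ([i, j, k] ! a) < xs ! ([i, j, k] ! b) \<longleftrightarrow> [p, q, r] ! a < [p, q, r] ! b))"
    (is "_ \<longleftrightarrow> ?R")
proof
  assume "contains_pattern xs [p, q, r]"
  then obtain f where f: "strict_mono_on {..<3} f" "\<forall>a<3. f a < length xs"
    "\<forall>a<3. \<forall>b<3. xs ! f a < xs ! f b \<longleftrightarrow> [p, q, r] ! a < [p, q, r] ! b"
    unfolding contains_pattern_def by (auto simp: numeral_3_eq_3)
  have "[f 0, f 1, f 2] ! a = f a" if "a < 3" for a
    using that by (auto simp: less_Suc_eq numeral_3_eq_3 numeral_2_eq_2)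
  moreover have "f 0 < f 1" "f 1 < f 2" using f(1) by (auto simp: monotone_on_def)
  ultimately show ?R using f(2,3)
    by (intro exI[of _ "f 0"] exI[of _ "f 1"] exI[of _ "f 2"]) simp
next
  assume ?R
  then obtain i j k where "i < j" "j < k" "k < length xs"
    "\<forall>a<3. \<forall>b<3. xs ! ([i, j, k] ! a) < xs ! ([i, j, k] ! b) \<longleftrightarrow> [p, q, r] ! a < [p, q, r] ! b"
    by blast
  then show "contains_pattern xs [p, q, r]"
    unfolding contains_pattern_def
    by (intro exI[of _ "\<lambda>a. [i, j, k] ! a"])
       (auto simp: numeral_3_eq_3 monotone_on_def less_Suc_eq)
qed

lemma avoids_312_iff:
  "avoids_pattern xs [3, 1, 2] \<longleftrightarrow> \<not> dominated_inversion (\<lambda>x. - int x) xs"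
proof -
  \<comment> \<open>Of the nine comparisons, three determine the order of the triple and imply the
    rest.\<close>
  have "(\<forall>a<3. \<forall>b<3. xs ! ([i, j, k] ! a) < xs ! ([i, j, k] ! b) \<longleftrightarrow>
          [3, 1, 2::nat] ! a < [3, 1, 2] ! b) \<longleftrightarrow>
        xs ! j < xs ! i \<and> xs ! k < xs ! i \<and> xs ! j < xs ! k" for i j k
    by (auto simp: numeral_3_eq_3 All_less_Suc)
  then show ?thesis
    unfolding avoids_pattern_def contains_pattern_length3 dominated_inversion_def by simp
qed

lemma avoids_321_iff:
  "avoids_pattern xs [3, 2, 1] \<longleftrightarrow> \<not> dominated_inversion int xs"
proof -
  have "(\<forall>a<3. \<forall>b<3. xs ! ([i, j, k] ! a) < xs ! ([i, j, k] ! b) \<longleftrightarrow>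
          [3, 2, 1::nat] ! a < [3, 2, 1] ! b) \<longleftrightarrow>
        xs ! j < xs ! i \<and> xs ! k < xs ! i \<and> xs ! k < xs ! j" for i j k
    by (auto simp: numeral_3_eq_3 All_less_Suc)
  then show ?thesis
    unfolding avoids_pattern_def contains_pattern_length3 dominated_inversion_def by simp
qed

section \<open>Counting by number of peaks\<close>

text \<open>The right-hand side is free of \<open>w\<close>, so both weights yield the same
  count.\<close>

lemma card_no_dominated_inversion_pk:
  assumes w: "strict_mono w \<or> strict_antimono_on UNIV w" and "finite A"
  shows "card {xs \<in> permutations_of_set A. \<not> dominated_inversion w xs \<and> pk xs = k} =
    card {m \<in> prefix_maxima ` permutations_of_set A.
      card {i. i + 2 < length m \<and> m ! i < m ! (i + 1) \<and> m ! (i + 2) = m ! (i + 1)} = k}"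
    (is "card ?L = card {m \<in> _. ?plateaus m = k}")
proof (rule bij_betw_same_card)
  let ?D = "{xs \<in> permutations_of_set A. \<not> dominated_inversion w xs}"
  have "inj w" using w
    by (auto simp: inj_def monotone_on_def) (metis linorder_neq_iff)+
  note bij = bij_betw_prefix_maxima[OF this \<open>finite A\<close>]
  \<comment> \<open>Within \<open>?D\<close> the peak count factors through
    \<open>prefix_maxima\<close>, so the bijection restricts to each value of
    \<open>k\<close>.\<close>
  have L: "?L = {xs \<in> ?D. ?plateaus (prefix_maxima xs) = k}"
    using pk_eq_card_prefix_maxima[OF _ _ w] by (auto simp: permutations_of_set_def)
  show "bij_betw prefix_maxima ?L {m \<in> prefix_maxima ` permutations_of_set A. ?plateaus m = k}"
    unfolding L
  proof (rule bij_betw_imageI)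
    show "inj_on prefix_maxima {xs \<in> ?D. ?plateaus (prefix_maxima xs) = k}"
      using bij_betw_imp_inj_on[OF bij] by (rule inj_on_subset) auto
    show "prefix_maxima ` {xs \<in> ?D. ?plateaus (prefix_maxima xs) = k} =
        {m \<in> prefix_maxima ` permutations_of_set A. ?plateaus m = k}"
      unfolding bij_betw_imp_surj_on[OF bij, symmetric] by blast
  qed
qed

theorem theorem2:
  fixes n k :: nat
  shows "a_pk n k [3, 1, 2] = a_pk n k [3, 2, 1]"
proof -
  have "strict_antimono_on UNIV (\<lambda>x. - int x)" "strict_mono int"
    by (auto simp: monotone_on_def)
  then show ?thesis
    unfolding a_pk_def avoids_312_iff avoids_321_iff by (simp add: card_no_dominated_inversion_pk)
qed

end
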